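(* Let $p\equiv 3\pmod 4$ be a prime, let $t$ be a positive integer, and let $q=p^{2t}$. For an integer $m\geq 1$, let $k_m(P^\ast(q))$ be the number of cliques of order $m$ in the Peisert graph $P^\ast(q)$. Then $$\lim_{q\to\infty}\frac{k_m(P^\ast(q))}{q^m}=\frac{1}{2^{\binom{m}{2}}\, m!}.$$
   Context: Let $g$ be a primitive element of $\mathbb{F}_q$. The Peisert graph $P^\ast(q)$ has vertex set $\mathbb{F}_q$, with $a\neq b$ adjacent iff $a-b\in\langle g^4\rangle\cup g\langle g^4\rangle$. A clique of order $m$ is a set of $m$ pairwise adjacent vertices. The limit is taken over $q$ of the form $p^{2t}$ with $p\equiv 3\pmod 4$ prime and $t\ge 1$. *)

theory Defs
  imports Complex_Main "HOL-Library.Ramsey" "HOL-Algebra.Algebra"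
begin

definition primitive_element :: "('a, 'b) ring_scheme \<Rightarrow> 'a \<Rightarrow> bool" where
  "primitive_element F g \<longleftrightarrow>
     g \<in> carrier (mult_of F) \<and> generate (mult_of F) {g} = carrier (mult_of F)"

definition peisert_set :: "('a, 'b) ring_scheme \<Rightarrow> 'a \<Rightarrow> 'a set" where
  "peisert_set F g =
     (let H = generate (mult_of F) {g [^]\<^bsub>mult_of F\<^esub> (4::nat)}
      in H \<union> (g <#\<^bsub>mult_of F\<^esub> H))"

(* Edges are unordered pairs, as in the notion "clique" of HOL-Library.Ramsey. For the
   orders q = p^(2t), p = 3 mod 4, considered here, q = 1 mod 8, so -1 is a fourth power
   and peisert_set is closed under negation; hence the order of a and b is immaterial. *)
definition peisert_edges :: "('a, 'b) ring_scheme \<Rightarrow> 'a \<Rightarrow> 'a set set" where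
  "peisert_edges F g =
     {{a, b} | a b. a \<in> carrier F \<and> b \<in> carrier F \<and> a \<noteq> b \<and> a \<ominus>\<^bsub>F\<^esub> b \<in> peisert_set F g}"

definition num_cliques :: "nat \<Rightarrow> 'a set \<Rightarrow> 'a set set \<Rightarrow> nat" where
  "num_cliques m V E = card {C. C \<subseteq> V \<and> finite C \<and> card C = m \<and> clique C E}"

definition peisert_orders :: "nat set" where
  "peisert_orders = {p ^ (2 * t) | p t. Factorial_Ring.prime p \<and> p mod 4 = 3 \<and> t \<ge> 1}"

text \<open>The limit over \<^const>\<open>peisert_orders\<close> is taken along
  \<^term>\<open>inf at_top (principal peisert_orders)\<close>, which is a proper filter.\<close>

lemma peisert_orders_filter_nontrivial: "inf at_top (principal peisert_orders) \<noteq> bot"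
proof -
  have "\<exists>q \<ge> N. q \<in> peisert_orders" for N
  proof (intro exI conjI)
    have "N < 2 ^ N" by (rule less_exp)
    also have "(2::nat) ^ N \<le> 3 ^ (2 * Suc N)"
      by (rule order_trans[OF power_mono[of 2 3] power_increasing]) auto
    finally show "N \<le> 3 ^ (2 * Suc N)" by simp
    have "Factorial_Ring.prime (3::nat)"
      unfolding prime_nat_iff
    proof (intro conjI allI impI)
      fix m :: nat assume "m dvd 3"
      moreover from this have "m \<le> 3" by (rule dvd_imp_le) simp
      ultimately show "m = 1 \<or> m = 3"
        by (cases "m = 0"; cases "m = 2") auto
    qed simp
    then show "3 ^ (2 * Suc N) \<in> peisert_orders"
      unfolding peisert_orders_def
      by (intro CollectI exI[of _ 3] exI[of _ "Suc N"]) auto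
  qed
  then show ?thesis
    unfolding trivial_limit_def eventually_inf_principal eventually_at_top_linorder by blast
qed

end

theory Submission
  imports Defs "HOL-Analysis.Convex"
begin

text \<open>Let \<open>\<chi>\<close> be the quartic character with \<open>\<chi>(g) = \<i>\<close>. Off the diagonal, the adjacency kernel of
  the Peisert graph is \<open>1/2 + Re ((1 - \<i>) \<chi>(a - b)) / 2\<close>. Since
  \<open>\<Sum>x. \<chi>(x - a) cnj (\<chi>(x - b)) = -1\<close> for \<open>a \<noteq> b\<close>, Cauchy--Schwarz bounds the bilinear form with
  kernel \<open>\<chi>(a - b)\<close>, on weights of modulus at most 1, by \<open>O(q\<^sup>3\<^sup>/\<^sup>2) = o(q\<^sup>2)\<close>; no Gauss or Jacobi
  sums are needed. Hence in the sum over all \<open>m\<close>-tuples of the product of the adjacencies of the pairs,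
  each factor can be replaced by \<open>1/2\<close> in turn, with a total error \<open>o(q\<^sup>m)\<close>. The sum counts every
  clique \<open>m!\<close> times.\<close>

section \<open>Counting in quasi-random kernels\<close>

lemma sum_PiE_insert:
  fixes h :: "('i \<Rightarrow> 'a) \<Rightarrow> 'b::comm_monoid_add"
  assumes "i \<notin> I"
  shows "(\<Sum>x\<in>insert i I \<rightarrow>\<^sub>E V. h x) = (\<Sum>x\<in>I \<rightarrow>\<^sub>E V. \<Sum>a\<in>V. h (x(i := a)))"
proof -
  have "(\<Sum>x\<in>insert i I \<rightarrow>\<^sub>E V. h x) = (\<Sum>(a, x)\<in>V \<times> (I \<rightarrow>\<^sub>E V). h (x(i := a)))"
    unfolding PiE_insert_eq
    by (subst sum.reindex[OF inj_combinator[OF assms]]) (simp add: case_prod_unfold)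
  also have "\<dots> = (\<Sum>x\<in>I \<rightarrow>\<^sub>E V. \<Sum>a\<in>V. h (x(i := a)))"
    by (subst sum.swap) (simp add: sum.cartesian_product)
  finally show ?thesis .
qed

text \<open>Fix all coordinates except \<open>i\<close> and \<open>j\<close>. The product over
  \<open>E\<close> then splits into a function of \<open>x i\<close> times a function of
  \<open>x j\<close>, both bounded by 1 because \<open>A\<close> is, so the hypothesis on
  \<open>B\<close> bounds the inner double sum. The remaining \<open>m - 2\<close> coordinates
  contribute the factor \<open>card V ^ (m - 2)\<close>.\<close>

lemma kernel_times_edges_bound:
  fixes A B :: "'a \<Rightarrow> 'a \<Rightarrow> real" and \<epsilon> :: real
  assumes "finite V"
    and A: "\<And>a b. a \<in> V \<Longrightarrow> b \<in> V \<Longrightarrow> 0 \<le> A a b \<and> A a b \<le> 1"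
    and B: "\<And>u v. (\<And>a. a \<in> V \<Longrightarrow> \<bar>u a\<bar> \<le> 1) \<Longrightarrow> (\<And>a. a \<in> V \<Longrightarrow> \<bar>v a\<bar> \<le> 1) \<Longrightarrow>
              \<bar>\<Sum>a\<in>V. \<Sum>b\<in>V. u a * B a b * v b\<bar> \<le> \<epsilon> * real (card V) ^ 2"
    and E: "E \<subseteq> {(i, j). i < j \<and> j < m}" and ij: "i < j" "j < m" "(i, j) \<notin> E"
  shows "\<bar>\<Sum>x\<in>{..<m} \<rightarrow>\<^sub>E V. B (x i) (x j) * (\<Prod>(k, l)\<in>E. A (x k) (x l))\<bar> \<le> \<epsilon> * real (card V) ^ m"
proof -
  define I where "I = {..<m} - {i, j}"
  have m: "{..<m} = insert i (insert j I)" and I: "i \<notin> insert j I" "j \<notin> I" "finite I"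
    using ij by (auto simp: I_def)
  have m2: "m = card I + 2"
    using arg_cong[OF m, of card] I by simp
  have finE: "finite E"
    by (rule finite_subset[OF E], rule finite_subset[of _ "{..<m} \<times> {..<m}"]) auto
  \<comment> \<open>As no pair in \<open>E\<close> contains both \<open>i\<close> and \<open>j\<close>, the product over \<open>E1\<close> does not depend on \<open>x j\<close>
    and the product over \<open>E2\<close> does not depend on \<open>x i\<close>.\<close>
  define E1 where "E1 = {e \<in> E. fst e = i \<or> snd e = i}"
  define E2 where "E2 = E - E1"
  have inner: "\<bar>\<Sum>a\<in>V. \<Sum>b\<in>V. B a b * (\<Prod>(k, l)\<in>E. A ((x(j := b, i := a)) k) ((x(j := b, i := a)) l))\<bar>
      \<le> \<epsilon> * real (card V) ^ 2" if x: "x \<in> I \<rightarrow>\<^sub>E V" for x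
  proof -
    define y where "y a b = x(j := b, i := a)" for a b
    \<comment> \<open>\<open>c\<close> is a dummy for the coordinate on which \<open>u\<close> or
      \<open>v\<close> does not depend. If \<open>V\<close> is empty, there is nothing to
      bound.\<close>
    obtain c where c: "c \<in> V \<or> V = {}" by blast
    define u where "u a = (\<Prod>(k, l)\<in>E1. A (y a c k) (y a c l))" for a
    define v where "v b = (\<Prod>(k, l)\<in>E2. A (y c b k) (y c b l))" for b
    have yV: "y a b k \<in> V" if "a \<in> V" "b \<in> V" "k < m" for a b k
      using that x by (auto simp: y_def I_def)
    have split: "(\<Prod>(k, l)\<in>E. A (y a b k) (y a b l)) = u a * v b" for a b
    proof -
      have "(\<Prod>(k, l)\<in>E. A (y a b k) (y a b l)) =
          (\<Prod>(k, l)\<in>E1. A (y a b k) (y a b l)) * (\<Prod>(k, l)\<in>E2. A (y a b k) (y a b l))"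
        unfolding E2_def using finE
        by (subst prod.subset_diff[of E1 E]) (auto simp: E1_def mult.commute)
      also have "(\<Prod>(k, l)\<in>E1. A (y a b k) (y a b l)) = u a"
        unfolding u_def using E ij
        by (intro prod.cong) (auto simp: E1_def y_def)
      also have "(\<Prod>(k, l)\<in>E2. A (y a b k) (y a b l)) = v b"
        unfolding v_def
        by (intro prod.cong) (auto simp: E2_def E1_def y_def)
      finally show ?thesis .
    qed
    have prod01: "\<bar>\<Prod>(k, l)\<in>F. A (y a b k) (y a b l)\<bar> \<le> 1" if "a \<in> V" "b \<in> V" "F \<subseteq> E" for a b F
    proof -
      have "0 \<le> A (y a b k) (y a b l) \<and> A (y a b k) (y a b l) \<le> 1" if "(k, l) \<in> F" for k l
        using that E \<open>a \<in> V\<close> \<open>b \<in> V\<close> \<open>F \<subseteq> E\<close> by (intro A yV) auto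
      then show ?thesis
        unfolding abs_prod by (intro prod_le_1) auto
    qed
    have "\<bar>\<Sum>a\<in>V. \<Sum>b\<in>V. u a * B a b * v b\<bar> \<le> \<epsilon> * real (card V) ^ 2"
    proof (rule B)
      show "\<bar>u a\<bar> \<le> 1" if "a \<in> V" for a
        unfolding u_def using that c by (intro prod01) (auto simp: E1_def)
      show "\<bar>v b\<bar> \<le> 1" if "b \<in> V" for b
        unfolding v_def using that c by (intro prod01) (auto simp: E2_def)
    qed
    then show ?thesis
      unfolding y_def[symmetric] split by (simp add: ac_simps)
  qed
  have "(\<Sum>x\<in>{..<m} \<rightarrow>\<^sub>E V. B (x i) (x j) * (\<Prod>(k, l)\<in>E. A (x k) (x l))) =
      (\<Sum>x\<in>I \<rightarrow>\<^sub>E V. \<Sum>a\<in>V. \<Sum>b\<in>V.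
        B a b * (\<Prod>(k, l)\<in>E. A ((x(j := b, i := a)) k) ((x(j := b, i := a)) l)))"
    unfolding m sum_PiE_insert[OF I(1)] sum_PiE_insert[OF I(2)]
    using ij by (subst sum.swap) simp
  also have "\<bar>\<dots>\<bar> \<le> (\<Sum>x\<in>I \<rightarrow>\<^sub>E V. \<epsilon> * real (card V) ^ 2)"
    by (rule order_trans[OF sum_abs sum_mono[OF inner]])
  also have "\<dots> = \<epsilon> * real (card V) ^ m"
    using I by (simp add: card_funcsetE m2 power_add power2_eq_square)
  finally show ?thesis .
qed

text \<open>Induction on the edge set, which is why \<open>E\<close> is an arbitrary set of pairs:
  write the factor of the new edge as \<open>(A - c) + c\<close>. The part with \<open>A - c\<close>
  is at most \<open>\<epsilon> * card V ^ m\<close> by the previous lemma; the part with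
  \<open>c\<close> inherits the old error, which does not grow because
  \<open>c \<le> 1\<close>.\<close>

lemma counting_lemma:
  fixes A :: "'a \<Rightarrow> 'a \<Rightarrow> real" and c \<epsilon> :: real
  assumes "finite V"
    and A: "\<And>a b. a \<in> V \<Longrightarrow> b \<in> V \<Longrightarrow> 0 \<le> A a b \<and> A a b \<le> 1"
    and c: "0 \<le> c" "c \<le> 1"
    and B: "\<And>u v. (\<And>a. a \<in> V \<Longrightarrow> \<bar>u a\<bar> \<le> 1) \<Longrightarrow> (\<And>a. a \<in> V \<Longrightarrow> \<bar>v a\<bar> \<le> 1) \<Longrightarrow>
              \<bar>\<Sum>a\<in>V. \<Sum>b\<in>V. u a * (A a b - c) * v b\<bar> \<le> \<epsilon> * real (card V) ^ 2"
    and E: "E \<subseteq> {(i, j). i < j \<and> j < m}"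
  shows "\<bar>(\<Sum>x\<in>{..<m} \<rightarrow>\<^sub>E V. \<Prod>(i, j)\<in>E. A (x i) (x j)) - c ^ card E * real (card V) ^ m\<bar>
           \<le> real (card E) * \<epsilon> * real (card V) ^ m"
proof -
  have "finite E"
    by (rule finite_subset[OF E], rule finite_subset[of _ "{..<m} \<times> {..<m}"]) auto
  then show ?thesis
    using E
  proof (induction E)
    case empty
    then show ?case using \<open>finite V\<close> by (simp add: card_funcsetE)
  next
    case (insert e E)
    obtain i j where e: "e = (i, j)" by fastforce
    define N where "N = (\<Sum>x\<in>{..<m} \<rightarrow>\<^sub>E V. \<Prod>(i, j)\<in>E. A (x i) (x j))"
    define D where "D = (\<Sum>x\<in>{..<m} \<rightarrow>\<^sub>E V. (A (x i) (x j) - c) * (\<Prod>(k, l)\<in>E. A (x k) (x l)))"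
    have D: "\<bar>D\<bar> \<le> \<epsilon> * real (card V) ^ m"
      unfolding D_def using insert e
      by (intro kernel_times_edges_bound[OF \<open>finite V\<close> A, where B = "\<lambda>a b. A a b - c"] B) auto
    have N: "\<bar>N - c ^ card E * real (card V) ^ m\<bar> \<le> real (card E) * \<epsilon> * real (card V) ^ m"
      unfolding N_def using insert by auto
    have "(\<Sum>x\<in>{..<m} \<rightarrow>\<^sub>E V. \<Prod>(i, j)\<in>insert e E. A (x i) (x j)) - c ^ card (insert e E) * real (card V) ^ m
        = D + c * (N - c ^ card E * real (card V) ^ m)"
      using insert.hyps
      by (simp add: D_def N_def e algebra_simps sum_subtractf sum_distrib_left)
    also have "\<bar>\<dots>\<bar> \<le> \<bar>D\<bar> + c * \<bar>N - c ^ card E * real (card V) ^ m\<bar>"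
      using c by (metis abs_mult abs_of_nonneg abs_triangle_ineq)
    also have "\<dots> \<le> \<bar>D\<bar> + \<bar>N - c ^ card E * real (card V) ^ m\<bar>"
      using c by (simp add: mult_left_le_one_le)
    also have "\<dots> \<le> real (card (insert e E)) * \<epsilon> * real (card V) ^ m"
      using D N insert.hyps by (simp add: algebra_simps)
    finally show ?case .
  qed
qed

section \<open>From tuples to cliques\<close>

lemma card_ordered_pairs: "card {(i, j). i < j \<and> j < m} = m choose 2" for m :: nat
proof -
  have "{(i, j). i < j \<and> j < m} = (SIGMA j:{..<m}. {..<j})\<inverse>" by auto
  then have "card {(i, j). i < j \<and> j < m} = (\<Sum>j<m. j)"
    by (simp add: card_inverse)
  also have "\<dots> = m choose 2"
    by (induction m) (simp_all add: numeral_2_eq_2)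
  finally show ?thesis .
qed

text \<open>The product is the indicator of the tuples that enumerate a clique of order
  \<open>m\<close> injectively, and each such clique has \<open>m!\<close> enumerations.\<close>

lemma sum_over_tuples_eq_num_cliques:
  fixes A :: "'a \<Rightarrow> 'a \<Rightarrow> real"
  assumes "finite V"
    and A: "\<And>a b. a \<in> V \<Longrightarrow> b \<in> V \<Longrightarrow> A a b = (if a \<noteq> b \<and> {a, b} \<in> E then 1 else 0)"
  shows "(\<Sum>x\<in>{..<m} \<rightarrow>\<^sub>E V. \<Prod>(i, j)\<in>{(i, j). i < j \<and> j < m}. A (x i) (x j)) =
    fact m * real (num_cliques m V E)"
proof -
  let ?P = "{(i, j). i < j \<and> j < m}"
  define K where "K = {C. C \<subseteq> V \<and> finite C \<and> card C = m \<and> clique C E}"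
  define T where "T C = {x \<in> {..<m} \<rightarrow>\<^sub>E C. inj_on x {..<m}}" for C :: "'a set"
  have finP: "finite ?P"
    by (rule finite_subset[of _ "{..<m} \<times> {..<m}"]) auto
  have finK: "finite K"
    by (rule finite_subset[of _ "Pow V"]) (auto simp: K_def \<open>finite V\<close>)
  have fin: "finite ({..<m} \<rightarrow>\<^sub>E V)"
    by (intro finite_PiE) (auto simp: \<open>finite V\<close>)
  \<comment> \<open>An injective \<open>m\<close>-tuple in a set of size \<open>m\<close> is onto,
    so it determines its clique. This makes the sets \<open>T C\<close> disjoint.\<close>
  have image: "x ` {..<m} = C" if "C \<in> K" "x \<in> T C" for x C
    using that by (intro card_subset_eq) (auto simp: K_def T_def card_image)
  have prod: "(\<Prod>(i, j)\<in>?P. A (x i) (x j)) = of_bool (x \<in> (\<Union>C\<in>K. T C))"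
    if x: "x \<in> {..<m} \<rightarrow>\<^sub>E V" for x
  proof -
    have xV: "x k \<in> V" if "k < m" for k using x that by auto
    show ?thesis
    proof (cases "\<forall>(i, j)\<in>?P. x i \<noteq> x j \<and> {x i, x j} \<in> E")
      case True
      have "i < j \<Longrightarrow> j < m \<Longrightarrow> x i \<noteq> x j" for i j using True by auto
      then have inj: "inj_on x {..<m}"
        by (intro linorder_inj_onI) auto
      have "i < j \<Longrightarrow> j < m \<Longrightarrow> {x i, x j} \<in> E" for i j using True by auto
      \<comment> \<open>The product tests only \<open>i < j\<close>; edges are unordered, so the
        other order follows.\<close>
      then have "{x i, x j} \<in> E" if "i < m" "j < m" "x i \<noteq> x j" for i j
        using that by (metis insert_commute linorder_neqE_nat)
      then have "x ` {..<m} \<in> K"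
        using x inj by (auto simp: K_def clique_def card_image)
      moreover have "x \<in> T (x ` {..<m})"
        using x inj by (auto simp: T_def)
      moreover have "(\<Prod>(i, j)\<in>?P. A (x i) (x j)) = 1"
        using True by (intro prod.neutral) (auto simp: A xV)
      ultimately show ?thesis by auto
    next
      case False
      then obtain i j where ij: "i < j" "j < m" "x i = x j \<or> {x i, x j} \<notin> E" by auto
      then have "A (x i) (x j) = 0"
        by (auto simp: A xV)
      then have "(\<Prod>(i, j)\<in>?P. A (x i) (x j)) = 0"
        using ij finP by (intro prod_zero) auto
      moreover have "x \<notin> T C" if "C \<in> K" for C
      proof
        assume "x \<in> T C"
        then have "x i \<noteq> x j" "x i \<in> C" "x j \<in> C"
          using ij by (auto simp: T_def inj_on_def)
        with that ij show False by (auto simp: K_def clique_def)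
      qed
      ultimately show ?thesis by auto
    qed
  qed
  have sub: "T C \<subseteq> {..<m} \<rightarrow>\<^sub>E V" if "C \<in> K" for C
    using that PiE_mono[of "{..<m}" "\<lambda>_. C" "\<lambda>_. V"] by (auto simp: T_def K_def)
  have cardT: "card (T C) = fact m" if "C \<in> K" for C
    using that card_inj_on_subset_funcset[of "{..<m}" C "{..<m}"]
    by (simp add: T_def K_def fact_prod_rev)
  have "(\<Sum>x\<in>{..<m} \<rightarrow>\<^sub>E V. \<Prod>(i, j)\<in>?P. A (x i) (x j)) = real (card (\<Union>C\<in>K. T C))"
  proof -
    have "(\<Sum>x\<in>{..<m} \<rightarrow>\<^sub>E V. \<Prod>(i, j)\<in>?P. A (x i) (x j)) =
        (\<Sum>x\<in>{..<m} \<rightarrow>\<^sub>E V. of_bool (x \<in> (\<Union>C\<in>K. T C)))"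
      by (intro sum.cong refl prod)
    also have "\<dots> = real (card (({..<m} \<rightarrow>\<^sub>E V) \<inter> (\<Union>C\<in>K. T C)))"
      using fin by (simp only: sum_of_bool_eq Collect_mem_eq)
    also have "({..<m} \<rightarrow>\<^sub>E V) \<inter> (\<Union>C\<in>K. T C) = (\<Union>C\<in>K. T C)"
      using sub by (intro Int_absorb1 UN_least)
    finally show ?thesis .
  qed
  also have "card (\<Union>C\<in>K. T C) = (\<Sum>C\<in>K. card (T C))"
  proof (intro card_UN_disjoint finK ballI impI)
    show "finite (T C)" if "C \<in> K" for C using sub[OF that] fin by (rule finite_subset)
    show "T C \<inter> T D = {}" if "C \<in> K" "D \<in> K" "C \<noteq> D" for C D
      using that image by (metis disjoint_iff)
  qed
  also have "\<dots> = fact m * card K" using cardT by simp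
  finally show ?thesis by (simp add: num_cliques_def K_def)
qed

section \<open>The quartic character and the Peisert graph\<close>

lemma i_power_mod_4: "\<i> ^ k = \<i> ^ (k mod 4)"
proof -
  have "\<i> ^ k = \<i> ^ (4 * (k div 4) + k mod 4)" by simp
  also have "\<dots> = (\<i> ^ 4) ^ (k div 4) * \<i> ^ (k mod 4)"
    by (simp only: power_add power_mult)
  also have "\<i> ^ 4 = 1" by (simp add: power4_eq_xxxx)
  finally show ?thesis by simp
qed

text \<open>HOL-Algebra defines \<^const>\<open>mult_of\<close> twice. The short name denotes the copy in
  \<^theory>\<open>HOL-Algebra.Ring_Divisibility\<close>, but the group structure is proved for the other one.\<close>

lemma mult_of_eq: "mult_of R = Multiplicative_Group.mult_of R"
  by (simp add: mult_of_def Multiplicative_Group.mult_of_def)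

text \<open>Divisibility of \<open>q - 1\<close> by 4 makes the quartic character well defined;
  divisibility by 8 makes -1 a fourth power, so that the character is even.\<close>

locale peisert_field = field R for R :: "('a, 'b) ring_scheme" (structure) +
  fixes g :: 'a
  assumes fin: "finite (carrier R)"
    and primitive: "primitive_element R g"
    and order_mod_8: "8 dvd order R - 1"
begin

sublocale mult: group "mult_of R"
  rewrites "carrier (mult_of R) = carrier R - {\<zero>}"
    and "monoid.mult (mult_of R) = monoid.mult R"
    and "one (mult_of R) = \<one>"
    and "(([^]\<^bsub>mult_of R\<^esub>) :: 'a \<Rightarrow> nat \<Rightarrow> 'a) = ([^])"
  using field_mult_group by (simp_all add: mult_of_eq Multiplicative_Group.nat_pow_mult_of)

lemma g_closed: "g \<in> carrier R" "g \<noteq> \<zero>"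
  using primitive by (auto simp: primitive_element_def)

lemma pow_g_nonzero: "g [^] (k::nat) \<in> carrier R - {\<zero>}"
  using mult_of.nat_pow_closed[of g k] g_closed by (simp add: nat_pow_mult_of)

lemma nonzero_eq_pow_g:
  assumes "x \<in> carrier R" "x \<noteq> \<zero>"
  obtains k :: nat where "x = g [^] k"
proof -
  have "x \<in> generate (mult_of R) {g}"
    using assms primitive by (simp add: primitive_element_def)
  then show thesis
    using mult.generate_pow_on_finite_carrier[of g] fin g_closed that by auto
qed

lemma order_gt_1: "order R > 1"
proof -
  have "card {\<zero>, \<one>} \<le> card (carrier R)"
    by (rule card_mono) (auto simp: fin)
  then show ?thesis by (simp add: order_def)
qed

lemma ord_g: "mult.ord g = order R - 1"
  using mult.generate_pow_card[of g] g_closed primitive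
  by (simp add: primitive_element_def order_def card_Diff_singleton)

section \<open>The quartic character\<close>

lemma pow_g_eq_imp_cong:
  assumes "g [^] (k::nat) = g [^] (l::nat)"
  shows "k mod 8 = l mod 8"
  using assms
proof (induction k l rule: linorder_wlog)
  case (le k l)
  have "g [^] (l - k) = \<one>"
    using mult.pow_eq_div2[of g l k] le g_closed by simp
  then have "order R - 1 dvd l - k"
    using mult.pow_eq_id[of g "l - k"] g_closed ord_g by simp
  then have "8 dvd l - k"
    using order_mod_8 dvd_trans by blast
  then show ?case
    using le by (metis mod_eq_dvd_iff_nat)
qed simp

text \<open>\<open>SOME\<close> picks one discrete logarithm to the base \<open>g\<close>. Any two
  agree modulo 8, hence modulo 4, so the power of \<open>\<i>\<close> does not depend on the choice.
  The value 0 at \<open>\<zero>\<close> keeps the map multiplicative on the whole field.\<close>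

definition \<chi> :: "'a \<Rightarrow> complex" where
  "\<chi> x = (if x \<in> carrier R - {\<zero>} then \<i> ^ (SOME k::nat. x = g [^] k) else 0)"

lemma \<chi>_pow_g: "\<chi> (g [^] k) = \<i> ^ k"
proof -
  define l where "l = (SOME l::nat. g [^] k = g [^] l)"
  have "g [^] k = g [^] l"
    unfolding l_def by (rule someI) (rule refl)
  then have "k mod 8 = l mod 8"
    by (rule pow_g_eq_imp_cong)
  then have "k mod 4 = l mod 4"
    by (metis mod_mod_cancel dvd_def numeral_Bit0_eq_double mult.commute)
  then have "\<i> ^ l = \<i> ^ k"
    by (metis i_power_mod_4)
  then show ?thesis
    using pow_g_nonzero by (simp add: \<chi>_def l_def)
qed

lemma \<chi>_zero [simp]: "\<chi> \<zero> = 0"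
  by (simp add: \<chi>_def)

lemma \<chi>_mult:
  assumes "x \<in> carrier R" "y \<in> carrier R"
  shows "\<chi> (x \<otimes> y) = \<chi> x * \<chi> y"
proof (cases "x = \<zero> \<or> y = \<zero>")
  case True
  then show ?thesis using assms by auto
next
  case False
  then obtain k l where "x = g [^] (k::nat)" "y = g [^] (l::nat)"
    using nonzero_eq_pow_g assms by metis
  then show ?thesis
    using g_closed by (simp add: nat_pow_mult \<chi>_pow_g power_add)
qed

lemma \<chi>_one [simp]: "\<chi> \<one> = 1"
  using \<chi>_pow_g[of 0] by simp

lemma norm_\<chi>: "x \<in> carrier R \<Longrightarrow> x \<noteq> \<zero> \<Longrightarrow> norm (\<chi> x) = 1"
  by (metis nonzero_eq_pow_g \<chi>_pow_g norm_power norm_ii power_one)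

lemma norm_\<chi>_le: "norm (\<chi> x) \<le> 1"
  using norm_\<chi> by (cases "x \<in> carrier R - {\<zero>}") (auto simp: \<chi>_def)

lemma \<chi>_cases:
  assumes "x \<in> carrier R" "x \<noteq> \<zero>"
  shows "\<chi> x \<in> {1, \<i>, -1, -\<i>}"
proof -
  obtain k where k: "x = g [^] (k::nat)" using nonzero_eq_pow_g assms by metis
  have "\<chi> x = \<i> ^ (k mod 4)" using k \<chi>_pow_g i_power_mod_4 by simp
  moreover have "k mod 4 \<in> {0, 1, 2, 3}" by auto
  ultimately show ?thesis by (auto simp: power3_eq_cube power2_eq_square)
qed

lemma cnj_\<chi>:
  assumes "x \<in> carrier R" "x \<noteq> \<zero>"
  shows "cnj (\<chi> x) = \<chi> (inv x)"
proof -
  have "\<chi> x * \<chi> (inv x) = 1"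
    using assms by (simp add: field_Units flip: \<chi>_mult)
  moreover have "\<chi> x * cnj (\<chi> x) = 1"
    using norm_\<chi>[OF assms] by (simp add: complex_norm_square[symmetric])
  moreover have "\<chi> x \<noteq> 0"
    using norm_\<chi>[OF assms] by auto
  ultimately show ?thesis
    by (metis mult_left_cancel)
qed

text \<open>With \<open>q - 1 = 8 * k\<close>, the element \<open>g [^] (4 * k)\<close> has order 2,
  hence is -1, and its exponent is a multiple of 4.\<close>

lemma \<chi>_minus_one: "\<chi> (\<ominus> \<one>) = 1"
proof -
  define k where "k = (order R - 1) div 8"
  have k: "order R - 1 = 8 * k" using order_mod_8 by (simp add: k_def)
  have "k > 0" using k order_gt_1 by simp
  define h where "h = g [^] (4 * k)"
  have h: "h \<in> carrier R" using g_closed by (simp add: h_def)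
  have "h \<otimes> h = g [^] (8 * k)"
    using g_closed by (simp add: h_def nat_pow_mult)
  also have "\<dots> = \<one>"
    using mult.pow_eq_id[of g "8 * k"] g_closed ord_g k by simp
  finally have "h \<otimes> h = \<one>" .
  moreover have "h \<noteq> \<one>"
    using mult.pow_eq_id[of g "4 * k"] g_closed ord_g k \<open>k > 0\<close>
    by (auto simp: h_def dest: dvd_imp_le)
  ultimately have "h = \<ominus> \<one>"
    using h by (meson square_eq_one)
  then have "\<chi> (\<ominus> \<one>) = \<i> ^ (4 * k)"
    by (metis h_def \<chi>_pow_g)
  then show ?thesis by (simp add: power_mult power4_eq_xxxx)
qed

lemma \<chi>_uminus:
  assumes "x \<in> carrier R"
  shows "\<chi> (\<ominus> x) = \<chi> x"
  using \<chi>_mult[of "\<ominus> \<one>" x] assms \<chi>_minus_one by (simp add: l_minus)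

lemma \<chi>_minus_commute:
  assumes "x \<in> carrier R" "y \<in> carrier R"
  shows "\<chi> (x \<ominus> y) = \<chi> (y \<ominus> x)"
  using \<chi>_uminus[of "y \<ominus> x"] assms by (simp add: minus_eq minus_add a_comm)

lemma minus_eq_zero_iff:
  assumes "x \<in> carrier R" "y \<in> carrier R"
  shows "x \<ominus> y = \<zero> \<longleftrightarrow> x = y"
  using assms by (metis minus_equality minus_minus r_neg minus_eq add.inv_closed)

lemma \<chi>_minus_self [simp]: "a \<in> carrier R \<Longrightarrow> \<chi> (a \<ominus> a) = 0"
  by (simp add: minus_eq r_neg)

section \<open>Character sums and mixing\<close>

text \<open>Multiplication by \<open>g\<close> permutes the field and multiplies the sum by
  \<open>\<i>\<close>, which differs from 1.\<close>

lemma sum_\<chi>: "(\<Sum>x\<in>carrier R. \<chi> x) = 0"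
proof -
  have inj: "inj_on ((\<otimes>) g) (carrier R)"
    using g_closed m_lcancel by (auto simp: inj_on_def)
  then have "(\<otimes>) g ` carrier R = carrier R"
    using g_closed by (intro endo_inj_surj fin) auto
  then have "(\<Sum>x\<in>carrier R. \<chi> x) = (\<Sum>x\<in>carrier R. \<chi> (g \<otimes> x))"
    using sum.reindex[OF inj, of \<chi>] by simp
  also have "\<dots> = \<i> * (\<Sum>x\<in>carrier R. \<chi> x)"
    using \<chi>_pow_g[of 1] g_closed by (simp add: \<chi>_mult sum_distrib_left)
  finally show ?thesis
    by simp
qed

text \<open>For \<open>x \<noteq> b\<close> the summand is \<open>\<chi>\<close> of the quotient \<open>(x - a) / (x - b) = 1 + (b - a) / (x - b)\<close>,
  which runs through all elements except \<open>1\<close>.\<close>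

lemma \<chi>_autocorrelation:
  assumes a: "a \<in> carrier R" and b: "b \<in> carrier R" and "a \<noteq> b"
  shows "(\<Sum>x\<in>carrier R. \<chi> (x \<ominus> a) * cnj (\<chi> (x \<ominus> b))) = -1"
proof -
  define T where "T x = (x \<ominus> a) \<otimes> inv (x \<ominus> b)" for x
  have d: "x \<ominus> b \<in> Units R" if "x \<in> carrier R - {b}" for x
    using that b minus_eq_zero_iff by (simp add: field_Units)
  have T: "T x \<otimes> (x \<ominus> b) = x \<ominus> a" "T x \<in> carrier R" if "x \<in> carrier R - {b}" for x
    using that a b d[OF that] by (simp_all add: T_def m_assoc)
  have inj: "inj_on T (carrier R - {b})"
  proof (rule inj_onI)
    fix x y assume x: "x \<in> carrier R - {b}" and y: "y \<in> carrier R - {b}" and eq: "T x = T y"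
    \<comment> \<open>Clearing denominators in \<open>T x = T y\<close>; the difference of the two
      sides factors as \<open>(x - y) (a - b)\<close>.\<close>
    have "(x \<ominus> a) \<otimes> (y \<ominus> b) = (y \<ominus> a) \<otimes> (x \<ominus> b)"
      using T[OF x] T[OF y] eq d[OF x] d[OF y]
      by (metis Units_closed m_assoc m_comm)
    moreover have "(x \<ominus> a) \<otimes> (y \<ominus> b) \<ominus> (y \<ominus> a) \<otimes> (x \<ominus> b) = (x \<ominus> y) \<otimes> (a \<ominus> b)"
      using x y a b by (simp, algebra)
    moreover have "(x \<ominus> a) \<otimes> (y \<ominus> b) \<ominus> (x \<ominus> a) \<otimes> (y \<ominus> b) = \<zero>"
      using x y a b by (simp add: minus_eq_zero_iff)
    ultimately have "(x \<ominus> y) \<otimes> (a \<ominus> b) = \<zero>"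
      by simp
    then show "x = y"
      using x y a b \<open>a \<noteq> b\<close> integral minus_eq_zero_iff by (metis DiffD1 minus_closed)
  qed
  have "T x \<noteq> \<one>" if x: "x \<in> carrier R - {b}" for x
  proof
    assume "T x = \<one>"
    then have "x \<ominus> b = x \<ominus> a" using T[OF x] x a b by simp
    then show False
      using x a b \<open>a \<noteq> b\<close> by (metis DiffD1 a_minus_def add.inv_closed add.l_cancel minus_minus)
  qed
  then have "T ` (carrier R - {b}) \<subseteq> carrier R - {\<one>}"
    using T by auto
  moreover have "card (T ` (carrier R - {b})) = card (carrier R - {\<one>})"
    using b by (simp add: card_image[OF inj] fin)
  ultimately have image: "T ` (carrier R - {b}) = carrier R - {\<one>}"
    by (intro card_subset_eq) (auto simp: fin)
  have "(\<Sum>x\<in>carrier R. \<chi> (x \<ominus> a) * cnj (\<chi> (x \<ominus> b))) =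
      (\<Sum>x\<in>carrier R - {b}. \<chi> (x \<ominus> a) * cnj (\<chi> (x \<ominus> b)))"
    using b by (intro sum.mono_neutral_right fin) auto
  also have "\<dots> = (\<Sum>x\<in>carrier R - {b}. \<chi> (T x))"
    using a b d minus_eq_zero_iff by (intro sum.cong) (auto simp: T_def \<chi>_mult cnj_\<chi>)
  also have "\<dots> = (\<Sum>x\<in>carrier R - {\<one>}. \<chi> x)"
    using sum.reindex[OF inj, of \<chi>] image by simp
  \<comment> \<open>The full sum vanishes, and the missing term is
    \<open>\<chi> \<one> = 1\<close>.\<close>
  also have "\<dots> = -1"
    using sum.remove[OF fin one_closed, of \<chi>] sum_\<chi> by (simp add: eq_neg_iff_add_eq_0 add.commute)
  finally show ?thesis .
qed

text \<open>The triangle inequality removes \<open>u\<close>, and Cauchy-Schwarz against the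
  constant 1 leaves \<open>q\<close> times the sum of the squares of \<open>norm (w a)\<close>.
  Expanding these squares produces the autocorrelations \<open>K b c\<close>: at most
  \<open>q\<close> in modulus on the diagonal and -1 off it. Each row of \<open>K\<close> thus has
  absolute sum at most \<open>2 * q\<close>, and all rows together at most
  \<open>2 * q^2\<close>.\<close>

lemma \<chi>_mixing:
  fixes u v :: "'a \<Rightarrow> real"
  assumes u: "\<And>a. a \<in> carrier R \<Longrightarrow> \<bar>u a\<bar> \<le> 1" and v: "\<And>a. a \<in> carrier R \<Longrightarrow> \<bar>v a\<bar> \<le> 1"
  shows "(norm (\<Sum>a\<in>carrier R. \<Sum>b\<in>carrier R. u a * \<chi> (a \<ominus> b) * v b))\<^sup>2 \<le> 2 * real (order R) ^ 3"
proof -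
  let ?q = "real (order R)"
  define w where "w a = (\<Sum>b\<in>carrier R. \<chi> (a \<ominus> b) * v b)" for a
  define K where "K b c = (\<Sum>a\<in>carrier R. \<chi> (a \<ominus> b) * cnj (\<chi> (a \<ominus> c)))" for b c
  have K_diag: "norm (K b b) \<le> ?q" for b
  proof -
    have "norm (K b b) \<le> (\<Sum>a\<in>carrier R. 1)"
      unfolding K_def using norm_\<chi>_le
      by (intro sum_norm_le) (simp add: norm_mult mult_le_one)
    then show ?thesis by (simp add: order_def)
  qed
  have K_sum: "(\<Sum>c\<in>carrier R. norm (K b c)) \<le> 2 * ?q" if b: "b \<in> carrier R" for b
  proof -
    have "(\<Sum>c\<in>carrier R. norm (K b c)) = norm (K b b) + (\<Sum>c\<in>carrier R - {b}. norm (K b c))"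
      by (rule sum.remove[OF fin b])
    also have "(\<Sum>c\<in>carrier R - {b}. norm (K b c)) = (\<Sum>c\<in>carrier R - {b}. 1)"
      unfolding K_def using b by (intro sum.cong) (auto simp: \<chi>_autocorrelation)
    also have "\<dots> \<le> ?q"
      using b by (simp add: fin order_def)
    finally show ?thesis using K_diag[of b] by simp
  qed
  have "complex_of_real (\<Sum>a\<in>carrier R. (norm (w a))\<^sup>2) = (\<Sum>a\<in>carrier R. w a * cnj (w a))"
    by (simp only: of_real_sum complex_norm_square)
  also have "\<dots> = (\<Sum>a\<in>carrier R. \<Sum>b\<in>carrier R. \<Sum>c\<in>carrier R.
      v b * v c * (\<chi> (a \<ominus> b) * cnj (\<chi> (a \<ominus> c))))"
    unfolding w_def by (simp add: sum_product ac_simps)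
  also have "\<dots> = (\<Sum>b\<in>carrier R. \<Sum>a\<in>carrier R. \<Sum>c\<in>carrier R.
      v b * v c * (\<chi> (a \<ominus> b) * cnj (\<chi> (a \<ominus> c))))"
    by (rule sum.swap)
  also have "\<dots> = (\<Sum>b\<in>carrier R. \<Sum>c\<in>carrier R. v b * v c * K b c)"
    unfolding K_def sum_distrib_left by (intro sum.cong refl sum.swap)
  finally have eq: "complex_of_real (\<Sum>a\<in>carrier R. (norm (w a))\<^sup>2) =
      (\<Sum>b\<in>carrier R. \<Sum>c\<in>carrier R. v b * v c * K b c)" .
  have "(\<Sum>a\<in>carrier R. (norm (w a))\<^sup>2) = norm (complex_of_real (\<Sum>a\<in>carrier R. (norm (w a))\<^sup>2))"
    unfolding norm_of_real by (simp add: sum_nonneg)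
  also have "\<dots> \<le> (\<Sum>b\<in>carrier R. \<Sum>c\<in>carrier R. norm (K b c))"
    unfolding eq
  proof (intro sum_norm_le)
    fix b c assume "b \<in> carrier R" "c \<in> carrier R"
    then have "\<bar>v b\<bar> * \<bar>v c\<bar> \<le> 1" using v by (intro mult_le_one) auto
    then show "norm (v b * v c * K b c) \<le> norm (K b c)"
      by (simp add: norm_mult abs_mult mult_left_le_one_le)
  qed
  also have "\<dots> \<le> (\<Sum>b\<in>carrier R. 2 * ?q)"
    by (intro sum_mono K_sum)
  finally have W: "(\<Sum>a\<in>carrier R. (norm (w a))\<^sup>2) \<le> 2 * ?q\<^sup>2"
    by (simp add: order_def power2_eq_square)
  have "norm (\<Sum>a\<in>carrier R. \<Sum>b\<in>carrier R. u a * \<chi> (a \<ominus> b) * v b) =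
      norm (\<Sum>a\<in>carrier R. u a * w a)"
    unfolding w_def by (simp add: sum_distrib_left mult.assoc)
  also have "\<dots> \<le> (\<Sum>a\<in>carrier R. norm (w a))"
    using u by (intro sum_norm_le) (simp add: norm_mult mult_left_le_one_le)
  finally have "(norm (\<Sum>a\<in>carrier R. \<Sum>b\<in>carrier R. u a * \<chi> (a \<ominus> b) * v b))\<^sup>2 \<le>
      (\<Sum>a\<in>carrier R. norm (w a))\<^sup>2"
    by (intro power_mono) auto
  also have "\<dots> \<le> (\<Sum>a\<in>carrier R. (norm (w a))\<^sup>2) * ?q"
    using sum_squared_le_sum_of_squares[of "\<lambda>a. norm (w a)" "carrier R"] by (simp add: order_def)
  also have "\<dots> \<le> 2 * ?q\<^sup>2 * ?q"
    using W by (intro mult_right_mono) auto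
  finally show ?thesis by (simp add: power2_eq_square power3_eq_cube)
qed

section \<open>Adjacency through the character\<close>

text \<open>The subgroup consists of the powers of \<open>g\<close> with exponent 0 modulo 4, its
  coset of those with exponent 1 modulo 4, and \<open>\<i> ^ k\<close> determines
  \<open>k mod 4\<close>.\<close>

lemma peisert_set_eq: "peisert_set R g = {x \<in> carrier R. \<chi> x = 1 \<or> \<chi> x = \<i>}"
proof -
  have g4: "g [^] (4::nat) \<in> carrier R - {\<zero>}" by (rule pow_g_nonzero)
  have H: "generate (mult_of R) {g [^] (4::nat)} = {g [^] (4 * k) | k::nat. True}"
    using mult.generate_pow_on_finite_carrier[of "g [^] (4::nat)"] fin g4 g_closed
    by (auto simp: nat_pow_pow)
  have coset: "g <#\<^bsub>mult_of R\<^esub> {g [^] (4 * k) | k::nat. True} = {g [^] (4 * k + 1) | k::nat. True}"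
    using g_closed by (auto simp: l_coset_def m_comm)
  have "peisert_set R g = {g [^] (4 * k) | k::nat. True} \<union> {g [^] (4 * k + 1) | k::nat. True}"
    unfolding peisert_set_def Let_def nat_pow_mult_of H coset ..
  also have "\<dots> = {x \<in> carrier R. \<chi> x = 1 \<or> \<chi> x = \<i>}" (is "?S = ?T")
  proof (intro equalityI subsetI)
    fix x assume "x \<in> ?S"
    then obtain k :: nat where "x = g [^] (4 * k) \<or> x = g [^] (4 * k + 1)" by blast
    moreover have "\<chi> (g [^] (4 * k)) = 1" "\<chi> (g [^] (4 * k + 1)) = \<i>"
      unfolding \<chi>_pow_g by (simp_all add: power_mult power4_eq_xxxx)
    ultimately show "x \<in> ?T"
      using g_closed by (auto simp del: nat_pow_Suc)
  next
    fix x assume x: "x \<in> ?T"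
    then have "x \<noteq> \<zero>" by auto
    with x obtain k where k: "x = g [^] (k::nat)" using nonzero_eq_pow_g by auto
    have "\<i> ^ (k mod 4) = 1 \<or> \<i> ^ (k mod 4) = \<i>"
      using x k \<chi>_pow_g[of k] i_power_mod_4[of k] by auto
    moreover have "k mod 4 \<in> {0, 1, 2, 3}" by auto
    ultimately have "k mod 4 = 0 \<or> k mod 4 = 1"
      by (auto simp: power3_eq_cube power2_eq_square complex_eq_iff)
    then have "k = 4 * (k div 4) \<or> k = 4 * (k div 4) + 1"
      by (metis mult_div_mod_eq add_0_right)
    then obtain j where "k = 4 * j \<or> k = 4 * j + 1" by blast
    then show "x \<in> ?S" using k by blast
  qed
  finally show ?thesis .
qed

text \<open>An edge may come from either order of its endpoints; evenness of \<open>\<chi>\<close>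
  makes the two conditions agree.\<close>

lemma peisert_edges_iff:
  assumes "a \<in> carrier R" "b \<in> carrier R"
  shows "{a, b} \<in> peisert_edges R g \<longleftrightarrow> a \<noteq> b \<and> (\<chi> (a \<ominus> b) = 1 \<or> \<chi> (a \<ominus> b) = \<i>)"
  using assms \<chi>_minus_commute[OF assms]
  by (auto simp: peisert_edges_def peisert_set_eq doubleton_eq_iff)

definition adj :: "'a \<Rightarrow> 'a \<Rightarrow> real" where
  "adj a b = of_bool (a \<noteq> b \<and> {a, b} \<in> peisert_edges R g)"

text \<open>\<open>Re ((1 - \<i>) * z)\<close> is 1 for \<open>z\<close> in \<open>{1, \<i>}\<close>
  and -1 for \<open>z\<close> in \<open>{-1, -\<i>}\<close>. On the diagonal \<open>\<chi>\<close>
  vanishes, which leaves the correction \<open>-1 / 2\<close>.\<close>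

lemma adj_eq_\<chi>:
  assumes "a \<in> carrier R" "b \<in> carrier R"
  shows "adj a b - 1 / 2 = Re ((1 - \<i>) * \<chi> (a \<ominus> b)) / 2 - of_bool (a = b) / 2"
proof (cases "a = b")
  case True
  then show ?thesis using assms by (simp add: adj_def)
next
  case False
  then have "\<chi> (a \<ominus> b) \<in> {1, \<i>, -1, -\<i>}"
    using assms minus_eq_zero_iff by (intro \<chi>_cases) auto
  then show ?thesis
    using False assms by (auto simp: adj_def peisert_edges_iff complex_eq_iff)
qed

text \<open>The character part is at most \<open>q * sqrt q\<close> and the diagonal part at most
  \<open>q\<close>, hence also at most \<open>q * sqrt q\<close>. The sum is written as a multiple
  of \<open>q^2\<close> to serve as the \<open>\<epsilon>\<close> of
  \<open>counting_lemma\<close>.\<close>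

lemma adj_mixing:
  fixes u v :: "'a \<Rightarrow> real"
  assumes u: "\<And>a. a \<in> carrier R \<Longrightarrow> \<bar>u a\<bar> \<le> 1" and v: "\<And>a. a \<in> carrier R \<Longrightarrow> \<bar>v a\<bar> \<le> 1"
  shows "\<bar>\<Sum>a\<in>carrier R. \<Sum>b\<in>carrier R. u a * (adj a b - 1 / 2) * v b\<bar> \<le>
    2 / sqrt (order R) * real (order R) ^ 2"
proof -
  let ?q = "real (order R)"
  define S where "S = (\<Sum>a\<in>carrier R. \<Sum>b\<in>carrier R. u a * \<chi> (a \<ominus> b) * v b)"
  define D where "D = (\<Sum>a\<in>carrier R. u a * v a)"
  have q: "?q \<ge> 1" using order_gt_1 by simp
  \<comment> \<open>\<open>1 - \<i>\<close> has squared modulus 2, which turns the bound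
    \<open>2 * q^3\<close> into \<open>4 * q^3\<close>.\<close>
  have "(norm ((1 - \<i>) * S))\<^sup>2 \<le> (2 * (?q * sqrt ?q))\<^sup>2"
  proof -
    have "(norm (1 - \<i>))\<^sup>2 = 2" by (simp add: cmod_power2)
    then have "(norm ((1 - \<i>) * S))\<^sup>2 = 2 * (norm S)\<^sup>2"
      by (simp add: norm_mult power_mult_distrib)
    also have "\<dots> \<le> 4 * ?q ^ 3"
      using \<chi>_mixing[OF u v] by (simp add: S_def)
    also have "\<dots> = (2 * (?q * sqrt ?q))\<^sup>2"
      by (simp add: power_mult_distrib power3_eq_cube power2_eq_square)
    finally show ?thesis .
  qed
  then have S: "norm ((1 - \<i>) * S) \<le> 2 * (?q * sqrt ?q)"
    by (rule power2_le_imp_le) simp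
  have "\<bar>D\<bar> \<le> (\<Sum>a\<in>carrier R. 1)"
    unfolding D_def using u v
    by (intro order_trans[OF sum_abs] sum_mono) (auto simp: abs_mult intro: mult_le_one)
  then have D: "\<bar>D\<bar> \<le> ?q" by (simp add: order_def)
  have "(\<Sum>a\<in>carrier R. \<Sum>b\<in>carrier R. u a * (adj a b - 1 / 2) * v b) =
      (\<Sum>a\<in>carrier R. \<Sum>b\<in>carrier R. Re ((1 - \<i>) * (u a * \<chi> (a \<ominus> b) * v b)) / 2
        - of_bool (a = b) * (u a * v b) / 2)"
    by (intro sum.cong refl) (simp add: adj_eq_\<chi> algebra_simps)
  also have "\<dots> = Re ((1 - \<i>) * S) / 2 - D / 2"
  proof -
    have "(\<Sum>a\<in>carrier R. \<Sum>b\<in>carrier R. of_bool (a = b) * (u a * v b)) = D"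
      unfolding D_def by (intro sum.cong refl) (simp add: fin of_bool_def if_distrib[of "\<lambda>x. x * _"] cong: if_cong)
    then show ?thesis
      unfolding S_def sum_distrib_left Re_sum
      by (simp only: sum_subtractf flip: sum_divide_distrib)
  qed
  also have "\<bar>\<dots>\<bar> \<le> norm ((1 - \<i>) * S) / 2 + \<bar>D\<bar> / 2"
    using abs_Re_le_cmod[of "(1 - \<i>) * S"] by linarith
  also have "\<dots> \<le> ?q * sqrt ?q + ?q"
    using S D by linarith
  also have "\<dots> \<le> 2 * (?q * sqrt ?q)"
    using mult_left_mono[of 1 "sqrt ?q" ?q] q by simp
  also have "\<dots> = 2 / sqrt ?q * ?q ^ 2"
    using q by (simp add: field_simps power2_eq_square)
  finally show ?thesis .
qed

lemma num_cliques_estimate: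
  "\<bar>fact m * real (num_cliques m (carrier R) (peisert_edges R g)) -
      (1 / 2) ^ (m choose 2) * real (order R) ^ m\<bar> \<le>
    real (m choose 2) * (2 / sqrt (order R)) * real (order R) ^ m"
proof -
  have "\<bar>(\<Sum>x\<in>{..<m} \<rightarrow>\<^sub>E carrier R. \<Prod>(i, j)\<in>{(i, j). i < j \<and> j < m}. adj (x i) (x j)) -
      (1 / 2) ^ card {(i, j). i < j \<and> j < m} * real (card (carrier R)) ^ m\<bar> \<le>
    real (card {(i, j). i < j \<and> j < m}) * (2 / sqrt (order R)) * real (card (carrier R)) ^ m"
    using adj_mixing
    by (intro counting_lemma fin) (auto simp: adj_def simp flip: order_def)
  moreover have "(\<Sum>x\<in>{..<m} \<rightarrow>\<^sub>E carrier R. \<Prod>(i, j)\<in>{(i, j). i < j \<and> j < m}. adj (x i) (x j)) =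
      fact m * real (num_cliques m (carrier R) (peisert_edges R g))"
    by (intro sum_over_tuples_eq_num_cliques fin) (simp add: adj_def)
  ultimately show ?thesis
    by (simp add: card_ordered_pairs order_def)
qed

end

section \<open>Passage to the limit\<close>

text \<open>Such an order is the square of an odd number, and
  \<open>(2 * k + 1)^2 - 1 = 4 * k * (k + 1)\<close> with \<open>k * (k + 1)\<close> even.\<close>

lemma peisert_orders_mod_8:
  assumes "q \<in> peisert_orders"
  shows "8 dvd q - 1"
proof -
  obtain p t where q: "q = (p ^ t) ^ 2" and p: "p mod 4 = 3"
    using assms by (auto simp: peisert_orders_def power_mult mult.commute simp flip: power_mult)
  have "odd p" using p by presburger
  then have "odd (p ^ t)" by simp
  then obtain k where k: "p ^ t = 2 * k + 1" by (elim oddE)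
  have "even (k * (k + 1))" by simp
  then obtain l where "k * (k + 1) = 2 * l" by (elim evenE)
  then have "q - 1 = 8 * l"
    unfolding q k by (simp add: power2_eq_square algebra_simps)
  then show ?thesis by simp
qed

theorem theorem1p3:
  fixes F :: "nat \<Rightarrow> 'a ring" and g :: "nat \<Rightarrow> 'a" and m :: nat
  assumes "m \<ge> 1"
    and "\<And>q. q \<in> peisert_orders \<Longrightarrow>
           field (F q) \<and> finite (carrier (F q)) \<and> order (F q) = q \<and> primitive_element (F q) (g q)"
  shows "((\<lambda>q. real (num_cliques m (carrier (F q)) (peisert_edges (F q) (g q))) / real q ^ m)
           \<longlongrightarrow> 1 / (2 ^ (m choose 2) * fact m)) (inf at_top (principal peisert_orders))"
proof -
  define N where "N q = real (num_cliques m (carrier (F q)) (peisert_edges (F q) (g q)))" for q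
  \<comment> \<open>The error in \<open>num_cliques_estimate\<close> divided by
    \<open>m! * q^m\<close> is \<open>C / sqrt q\<close>.\<close>
  define C where "C = 2 * real (m choose 2) / fact m"
  have est: "norm (N q / real q ^ m - 1 / (2 ^ (m choose 2) * fact m)) \<le> C / sqrt (real q)"
    if q: "q \<in> peisert_orders" for q
  proof -
    have Fq: "field (F q)" "finite (carrier (F q))" "order (F q) = q" "primitive_element (F q) (g q)"
      using assms(2)[OF q] by auto
    interpret peisert_field "F q" "g q"
      using Fq peisert_orders_mod_8[OF q]
      by (intro peisert_field.intro peisert_field_axioms.intro) auto
    have "q > 0" using order_gt_1 Fq by simp
    have "\<bar>fact m * N q - (1 / 2) ^ (m choose 2) * real q ^ m\<bar> \<le>
        real (m choose 2) * (2 / sqrt q) * real q ^ m"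
      using num_cliques_estimate[of m] by (simp add: N_def Fq)
    moreover have "N q / real q ^ m - 1 / (2 ^ (m choose 2) * fact m) =
        (fact m * N q - (1 / 2) ^ (m choose 2) * real q ^ m) / (fact m * real q ^ m)"
      using \<open>q > 0\<close> by (simp add: field_simps power_divide)
    ultimately show ?thesis
      using \<open>q > 0\<close> by (simp add: C_def abs_divide divide_le_eq field_simps)
  qed
  have "((\<lambda>q. C / sqrt (real q)) \<longlongrightarrow> 0) at_top"
    by (intro tendsto_divide_0[OF tendsto_const] filterlim_at_top_imp_at_infinity
        filterlim_compose[OF sqrt_at_top filterlim_real_sequentially])
  then have "((\<lambda>q. C / sqrt (real q)) \<longlongrightarrow> 0) (inf at_top (principal peisert_orders))"
    by (rule tendsto_mono[OF inf_le1])
  \<comment> \<open>The factor 1 is the constant in the comparison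
    \<open>tendsto_0_le\<close>.\<close>
  moreover have "\<forall>\<^sub>F q in inf at_top (principal peisert_orders).
      norm (N q / real q ^ m - 1 / (2 ^ (m choose 2) * fact m)) \<le> norm (C / sqrt (real q)) * 1"
    unfolding eventually_inf_principal
  proof (intro always_eventually allI impI)
    fix q assume "q \<in> peisert_orders"
    from order_trans[OF est[OF this] abs_ge_self]
    show "norm (N q / real q ^ m - 1 / (2 ^ (m choose 2) * fact m)) \<le> norm (C / sqrt (real q)) * 1"
      by (simp only: real_norm_def mult_1_right)
  qed
  ultimately have "((\<lambda>q. N q / real q ^ m - 1 / (2 ^ (m choose 2) * fact m)) \<longlongrightarrow> 0)
      (inf at_top (principal peisert_orders))"
    by (rule tendsto_0_le)
  then show ?thesis
    unfolding N_def by (rule LIM_zero_cancel)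
qed

end
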